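(* Let $A \in \mathrm{Sp}(n,1)$ be a hyperbolic element written as $A=i_1i_2$ with $i_1,i_2\in\mathrm{Sp}(n,1)$ and $i_1^2=i_2^2=-I$. Then each of $i_1$ and $i_2$ maps the set of the two boundary fixed points of $A$ to itself.
   Context: $\mathbb{H}^{n+1}$ is a right $\mathbb{H}$-vector space with Hermitian form $\langle \mathbf z,\mathbf w\rangle = \bar w_{n+1} z_1 + \sum_{i=2}^{n} \bar w_i z_i + \bar w_1 z_{n+1}$; $\mathrm{Sp}(n,1)$ is the group of quaternionic matrices preserving it, acting on the boundary of quaternionic hyperbolic space (the set of right quaternionic lines of nonzero null vectors). An element is hyperbolic if it has exactly two fixed points on this boundary. *)

theory Defs
  imports Complex_Main
begin

datatype quat = Quat (qr: real) (qi: real) (qj: real) (qk: real)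

lemma quat_eqI: "qr a = qr b \<Longrightarrow> qi a = qi b \<Longrightarrow> qj a = qj b \<Longrightarrow> qk a = qk b \<Longrightarrow> a = b"
  by (cases a; cases b) simp

instantiation quat :: ring_1
begin
definition "0 = Quat 0 0 0 0"
definition "1 = Quat 1 0 0 0"
definition "a + b = Quat (qr a + qr b) (qi a + qi b) (qj a + qj b) (qk a + qk b)"
definition "- a = Quat (- qr a) (- qi a) (- qj a) (- qk a)"
definition "a - b = Quat (qr a - qr b) (qi a - qi b) (qj a - qj b) (qk a - qk b)"
definition "a * b = Quat
   (qr a * qr b - qi a * qi b - qj a * qj b - qk a * qk b)
   (qr a * qi b + qi a * qr b + qj a * qk b - qk a * qj b)
   (qr a * qj b - qi a * qk b + qj a * qr b + qk a * qi b)
   (qr a * qk b + qi a * qj b - qj a * qi b + qk a * qr b)"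
instance
  by standard (auto intro!: quat_eqI simp: zero_quat_def one_quat_def plus_quat_def
      uminus_quat_def minus_quat_def times_quat_def algebra_simps)
end

definition qcnj :: "quat \<Rightarrow> quat" where
  "qcnj a = Quat (qr a) (- qi a) (- qj a) (- qk a)"

definition vecs :: "nat \<Rightarrow> (nat \<Rightarrow> quat) set" where
  "vecs n = {z. \<forall>i. (i < 1 \<or> i > n + 1) \<longrightarrow> z i = 0}"

definition herm :: "nat \<Rightarrow> (nat \<Rightarrow> quat) \<Rightarrow> (nat \<Rightarrow> quat) \<Rightarrow> quat" where
  "herm n z w = qcnj (w (n + 1)) * z 1 + (\<Sum>i = 2..n. qcnj (w i) * z i) + qcnj (w 1) * z (n + 1)"

definition rsmult :: "(nat \<Rightarrow> quat) \<Rightarrow> quat \<Rightarrow> (nat \<Rightarrow> quat)" where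
  "rsmult z c = (\<lambda>i. z i * c)"

text \<open>Matrices: functions nat => nat => quat, only entries in {1..n+1}^2 matter.\<close>
definition mvec :: "nat \<Rightarrow> (nat \<Rightarrow> nat \<Rightarrow> quat) \<Rightarrow> (nat \<Rightarrow> quat) \<Rightarrow> (nat \<Rightarrow> quat)" where
  "mvec n A z = (\<lambda>i. if 1 \<le> i \<and> i \<le> n + 1 then (\<Sum>j = 1..n + 1. A i j * z j) else 0)"

definition mmul :: "nat \<Rightarrow> (nat \<Rightarrow> nat \<Rightarrow> quat) \<Rightarrow> (nat \<Rightarrow> nat \<Rightarrow> quat) \<Rightarrow> (nat \<Rightarrow> nat \<Rightarrow> quat)" where
  "mmul n A B = (\<lambda>i j. \<Sum>k = 1..n + 1. A i k * B k j)"

definition mat_eq :: "nat \<Rightarrow> (nat \<Rightarrow> nat \<Rightarrow> quat) \<Rightarrow> (nat \<Rightarrow> nat \<Rightarrow> quat) \<Rightarrow> bool" where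
  "mat_eq n A B \<longleftrightarrow> (\<forall>i \<in> {1..n + 1}. \<forall>j \<in> {1..n + 1}. A i j = B i j)"

definition neg_id :: "nat \<Rightarrow> nat \<Rightarrow> quat" where
  "neg_id = (\<lambda>i j. if i = j then - 1 else 0)"

definition Sp :: "nat \<Rightarrow> (nat \<Rightarrow> nat \<Rightarrow> quat) \<Rightarrow> bool" where
  "Sp n A \<longleftrightarrow> (\<forall>z \<in> vecs n. \<forall>w \<in> vecs n. herm n (mvec n A z) (mvec n A w) = herm n z w)"

definition qline :: "(nat \<Rightarrow> quat) \<Rightarrow> (nat \<Rightarrow> quat) set" where
  "qline z = {rsmult z c | c. c \<noteq> 0}"

definition boundary :: "nat \<Rightarrow> (nat \<Rightarrow> quat) set set" where
  "boundary n = {qline z | z. z \<in> vecs n \<and> z \<noteq> (\<lambda>_. 0) \<and> herm n z z = 0}"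

definition act :: "nat \<Rightarrow> (nat \<Rightarrow> nat \<Rightarrow> quat) \<Rightarrow> (nat \<Rightarrow> quat) set \<Rightarrow> (nat \<Rightarrow> quat) set" where
  "act n A L = mvec n A ` L"

definition bfix :: "nat \<Rightarrow> (nat \<Rightarrow> nat \<Rightarrow> quat) \<Rightarrow> (nat \<Rightarrow> quat) set set" where
  "bfix n A = {L \<in> boundary n. act n A L = L}"

definition hyperbolic :: "nat \<Rightarrow> (nat \<Rightarrow> nat \<Rightarrow> quat) \<Rightarrow> bool" where
  "hyperbolic n A \<longleftrightarrow> Sp n A \<and> card (bfix n A) = 2"

end

theory Submission
  imports Defs
begin

text \<open>
  Since \<open>-I\<close> fixes every quaternionic line, the hypotheses \<open>i\<^sub>1\<^sup>2 = i\<^sub>2\<^sup>2 = -I\<close> make \<open>i\<^sub>1\<close> and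
  \<open>i\<^sub>2\<close> act as involutions on the boundary, and \<open>A\<close> acts as their composite. If
  \<open>i\<^sub>1 (i\<^sub>2 L) = L\<close>, applying \<open>i\<^sub>1\<close> gives \<open>i\<^sub>2 L = i\<^sub>1 L\<close>, and then
  \<open>i\<^sub>1 (i\<^sub>2 (i\<^sub>1 L)) = i\<^sub>1 (i\<^sub>2 (i\<^sub>2 L)) = i\<^sub>1 L\<close>: both involutions permute the fixed points of
  their composite.
\<close>

lemma involutions_permute_fixpoints_of_composite:
  assumes f_closed: "\<And>x. x \<in> S \<Longrightarrow> f x \<in> S" and f_inv: "\<And>x. x \<in> S \<Longrightarrow> f (f x) = x"
    and g_closed: "\<And>x. x \<in> S \<Longrightarrow> g x \<in> S" and g_inv: "\<And>x. x \<in> S \<Longrightarrow> g (g x) = x"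
  shows "f ` {x \<in> S. f (g x) = x} = {x \<in> S. f (g x) = x}"
    and "g ` {x \<in> S. f (g x) = x} = {x \<in> S. f (g x) = x}"
proof -
  let ?F = "{x \<in> S. f (g x) = x}"
  have f_eq_g: "f x = g x" if "x \<in> ?F" for x
  proof -
    from that have "x \<in> S" "f (g x) = x" by auto
    then have "f (f (g x)) = f x" by simp
    with \<open>x \<in> S\<close> show ?thesis by (simp add: f_inv g_closed)
  qed
  have f_maps: "f x \<in> ?F" if "x \<in> ?F" for x
  proof -
    from that have "x \<in> S" by simp
    then have "f (g (f x)) = f x" by (simp add: f_eq_g[OF that] g_inv)
    with \<open>x \<in> S\<close> show ?thesis by (simp add: f_closed)
  qed
  show f_perm: "f ` ?F = ?F"
  proof
    show "?F \<subseteq> f ` ?F"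
    proof
      fix x assume "x \<in> ?F"
      then have "x = f (f x)" by (simp add: f_inv)
      with f_maps[OF \<open>x \<in> ?F\<close>] show "x \<in> f ` ?F" by blast
    qed
  qed (use f_maps in blast)
  have "g ` ?F = f ` ?F"
    using f_eq_g by (intro image_cong) simp_all
  with f_perm show "g ` ?F = ?F"
    by simp
qed

declare sum.cl_ivl_Suc[simp del]

lemma mvec_mmul: "mvec n (mmul n B C) z = mvec n B (mvec n C z)"
proof
  fix i
  have "(\<Sum>j = 1..n + 1. B i j * (if 1 \<le> j \<and> j \<le> n + 1 then \<Sum>k = 1..n + 1. C j k * z k else 0))
      = (\<Sum>j = 1..n + 1. \<Sum>k = 1..n + 1. B i j * (C j k * z k))"
    by (rule sum.cong[OF refl], subst if_P, simp, rule sum_distrib_left)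
  also have "\<dots> = (\<Sum>k = 1..n + 1. \<Sum>j = 1..n + 1. B i j * (C j k * z k))"
    by (rule sum.swap)
  also have "\<dots> = (\<Sum>k = 1..n + 1. (\<Sum>j = 1..n + 1. B i j * C j k) * z k)"
    by (simp add: sum_distrib_right mult.assoc)
  finally show "mvec n (mmul n B C) z i = mvec n B (mvec n C z) i"
    by (simp add: mvec_def mmul_def)
qed

lemma mvec_cong: "mat_eq n B C \<Longrightarrow> mvec n B z = mvec n C z"
  unfolding mvec_def mat_eq_def by (intro ext) (auto intro!: sum.cong)

lemma mvec_in_vecs: "mvec n M z \<in> vecs n"
  by (simp add: mvec_def vecs_def)

lemma mvec_zero: "mvec n M (\<lambda>_. 0) = (\<lambda>_. 0)"
  by (simp add: mvec_def fun_eq_iff)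

lemma mvec_rsmult: "mvec n M (rsmult z c) = rsmult (mvec n M z) c"
  by (auto simp: mvec_def rsmult_def sum_distrib_right mult.assoc fun_eq_iff)

lemma mvec_neg_id:
  assumes z: "z \<in> vecs n"
  shows "mvec n neg_id z = rsmult z (-1)"
proof
  fix i
  show "mvec n neg_id z i = rsmult z (-1) i"
  proof (cases "1 \<le> i \<and> i \<le> n + 1")
    case True
    have "(\<Sum>j = 1..n + 1. neg_id i j * z j) = (\<Sum>j = 1..n + 1. if j = i then - z j else 0)"
      by (intro sum.cong) (auto simp: neg_id_def)
    also have "\<dots> = - z i"
      using True by (simp add: sum.delta')
    finally show ?thesis
      using True by (simp add: mvec_def rsmult_def)
  next
    case False
    then have "i < 1 \<or> i > n + 1"
      by linarith
    then have "z i = 0"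
      using z unfolding vecs_def by blast
    with False show ?thesis
      unfolding mvec_def rsmult_def by (simp only: if_False mult_zero_left)
  qed
qed

lemma qline_rsmult_neg_one: "qline (rsmult z (-1)) = qline z"
proof -
  have "rsmult (rsmult z (-1)) c = rsmult z (- c)" for c
    by (simp add: rsmult_def)
  then show ?thesis
    unfolding qline_def by (auto, metis minus_minus neg_equal_0_iff_equal)
qed

lemma act_mmul: "act n (mmul n B C) L = act n B (act n C L)"
  by (simp add: act_def image_image mvec_mmul)

lemma act_cong: "mat_eq n B C \<Longrightarrow> act n B L = act n C L"
  by (simp add: act_def mvec_cong)

lemma act_qline: "act n M (qline z) = qline (mvec n M z)"
proof
  show "act n M (qline z) \<subseteq> qline (mvec n M z)"
    unfolding act_def qline_def by (auto simp: mvec_rsmult)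
  show "qline (mvec n M z) \<subseteq> act n M (qline z)"
  proof
    fix x assume "x \<in> qline (mvec n M z)"
    then obtain c where "c \<noteq> 0" "x = mvec n M (rsmult z c)"
      by (auto simp: qline_def mvec_rsmult)
    then show "x \<in> act n M (qline z)"
      by (auto simp: act_def qline_def)
  qed
qed

lemma act_neg_id_boundary: "L \<in> boundary n \<Longrightarrow> act n neg_id L = L"
  by (auto simp: boundary_def act_qline mvec_neg_id qline_rsmult_neg_one)

lemma act_square_neg_id:
  assumes "mat_eq n (mmul n M M) neg_id" "L \<in> boundary n"
  shows "act n M (act n M L) = L"
  using assms by (simp add: act_mmul[symmetric] act_cong act_neg_id_boundary)

text \<open>The hypothesis on \<open>M\<^sup>2\<close> replaces the nondegeneracy of the form: it makes \<open>M\<close> injective.\<close>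

lemma act_boundary:
  assumes "Sp n M" "mat_eq n (mmul n M M) neg_id" "L \<in> boundary n"
  shows "act n M L \<in> boundary n"
proof -
  obtain z where z: "L = qline z" "z \<in> vecs n" "z \<noteq> (\<lambda>_. 0)" "herm n z z = 0"
    using assms(3) by (auto simp: boundary_def)
  have "mvec n M (mvec n M z) = rsmult z (-1)"
    using mvec_mmul mvec_cong[OF assms(2)] mvec_neg_id[OF z(2)] by metis
  then have "mvec n M z \<noteq> (\<lambda>_. 0)"
    using z(3) mvec_zero by (fastforce simp: rsmult_def fun_eq_iff)
  moreover have "herm n (mvec n M z) (mvec n M z) = 0"
    using assms(1) z(2,4) by (simp add: Sp_def)
  ultimately show ?thesis
    using z(1) mvec_in_vecs by (auto simp: boundary_def act_qline)
qed

theorem lemma2p3: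
  fixes n :: nat and A i1 i2 :: "nat \<Rightarrow> nat \<Rightarrow> quat"
  assumes "n \<ge> 1"
    and "hyperbolic n A"
    and "Sp n i1" and "Sp n i2"
    and "mat_eq n A (mmul n i1 i2)"
    and "mat_eq n (mmul n i1 i1) neg_id"
    and "mat_eq n (mmul n i2 i2) neg_id"
  shows "act n i1 ` bfix n A = bfix n A \<and> act n i2 ` bfix n A = bfix n A"
proof -
  have "bfix n A = {L \<in> boundary n. act n i1 (act n i2 L) = L}"
    by (simp add: bfix_def act_cong[OF assms(5)] act_mmul)
  then show ?thesis
    using involutions_permute_fixpoints_of_composite
      [of "boundary n" "act n i1" "act n i2",
       OF act_boundary[OF assms(3,6)] act_square_neg_id[OF assms(6)]
          act_boundary[OF assms(4,7)] act_square_neg_id[OF assms(7)]]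
    by (simp only: conj_absorb)
qed

end
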